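(* Let $A$ be a (possibly infinite) alphabet and let $<$ be the generalized lexicographic order induced by a sequence $(<_n)_{n\in\mathbb{N}}$ of total orders on $A$. Let $w$ be a primitive infinite word over $A$. Then $w$ is an infinite generalized Lyndon word if and only if infinitely many of the finite prefixes of $w$ are generalized Lyndon words.
   Context: $\mathbb{N}=\{1,2,3,\dots\}$. Words are finite or infinite (to the right) sequences of letters of $A$. For each $n\in\mathbb{N}$ let $<_n$ be a total order on $A$. The generalized lexicographic order $<$ induced by $(<_n)_{n\in\mathbb{N}}$ on finite and infinite words is: $x<y$ if and only if $x$ is a proper prefix of $y$, or $x=pas$ and $y=pbs'$ for words $p,s,s'$ ($p$ finite) and letters $a,b$ with $a<_{|p|+1}b$. For a nonempty finite word $u$, $u^\omega$ is the infinite word $uuu\cdots$. An infinite word is primitive if it is not of the form $u^\omega$ for any nonempty finite word $u$. A nonempty finite word $w$ is generalized Lyndon if $uv<vu$ for every factorization $w=uv$ with $u,v$ both nonempty. An infinite word $w$ is generalized Lyndon if $w<v$ for every factorization $w=uv$ with $u$ a nonempty finite word. *)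

theory Defs
  imports Main "HOL-Library.Stream"
begin

datatype 'a word = Fin "'a list" | Inf "'a stream"

fun prepend :: "'a list \<Rightarrow> 'a word \<Rightarrow> 'a word" where
  "prepend p (Fin s) = Fin (p @ s)"
| "prepend p (Inf s) = Inf (p @- s)"

(* (a, b) \<in> r n stands for the strict comparison of a and b in the n-th order;
   letter positions, hence the indices n, are counted from 1. *)
definition glex_less :: "(nat \<Rightarrow> 'a rel) \<Rightarrow> 'a word \<Rightarrow> 'a word \<Rightarrow> bool" where
  "glex_less r x y \<longleftrightarrow>
     (\<exists>p s. s \<noteq> Fin [] \<and> x = Fin p \<and> y = prepend p s) \<or>
     (\<exists>p a b s s'. x = prepend p (prepend [a] s) \<and> y = prepend p (prepend [b] s')
        \<and> (a, b) \<in> r (length p + 1))"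

definition primitive_inf :: "'a stream \<Rightarrow> bool" where
  "primitive_inf w \<longleftrightarrow> \<not> (\<exists>u. u \<noteq> [] \<and> w = cycle u)"

definition gen_lyndon_fin :: "(nat \<Rightarrow> 'a rel) \<Rightarrow> 'a list \<Rightarrow> bool" where
  "gen_lyndon_fin r w \<longleftrightarrow> w \<noteq> [] \<and>
     (\<forall>u v. u \<noteq> [] \<longrightarrow> v \<noteq> [] \<longrightarrow> w = u @ v \<longrightarrow> glex_less r (Fin (u @ v)) (Fin (v @ u)))"

definition gen_lyndon_inf :: "(nat \<Rightarrow> 'a rel) \<Rightarrow> 'a stream \<Rightarrow> bool" where
  "gen_lyndon_inf r w \<longleftrightarrow>
     (\<forall>u v. u \<noteq> [] \<longrightarrow> w = u @- v \<longrightarrow> glex_less r (Inf w) (Inf v))"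

end

theory Submission imports Defs "HOL-Library.Infinite_Set"
begin

text \<open>
  For a fixed prefix \<open>p\<close> of \<open>w\<close>, let \<open>v\<close> be the shortest among the nonempty suffixes of \<open>p\<close> with
  minimal \<open>v\<^sup>\<omega>\<close>. Then \<open>v\<close> is generalized Lyndon, and if \<open>w\<close> is generalized Lyndon, \<open>v\<close> is also
  a prefix of \<open>w\<close>. Suppose that \<open>w\<close> has only finitely many generalized Lyndon prefixes, and let
  \<open>m\<close> be the largest value of \<open>v\<^sup>\<omega>\<close> attained for infinitely many \<open>p\<close>. Removing \<open>v\<close> from the end
  of \<open>p\<close> does not decrease the minimal value, so by maximality of \<open>m\<close> all long prefixes with value
  \<open>m\<close> end in products of words \<open>v\<close> with \<open>v\<^sup>\<omega> = m\<close>, and \<open>m\<close> itself is a proper suffix of \<open>w\<close>.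
  Hence \<open>w < m\<close>; but \<open>m \<le> p\<^sup>\<omega>\<close> for infinitely many \<open>p\<close>, so that \<open>m \<le> w\<close> in the limit.
  Conversely, for primitive \<open>w\<close> every comparison of \<open>w\<close> with a proper suffix is decided inside a
  sufficiently long generalized Lyndon prefix.
\<close>

section \<open>Sequences and periodic words\<close>

definition seq_less :: "(nat \<Rightarrow> 'a rel) \<Rightarrow> (nat \<Rightarrow> 'a) \<Rightarrow> (nat \<Rightarrow> 'a) \<Rightarrow> bool" where
  "seq_less r x y \<longleftrightarrow> (\<exists>d. (\<forall>j<d. x j = y j) \<and> (x d, y d) \<in> r (Suc d))"

definition omega :: "'a list \<Rightarrow> nat \<Rightarrow> 'a" where
  "omega u i = u ! (i mod length u)"

lemma ex_first_difference:
  fixes x y :: "nat \<Rightarrow> 'a"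
  assumes "x \<noteq> y"
  obtains d where "\<forall>j<d. x j = y j" "x d \<noteq> y d"
proof -
  from assms have "\<exists>d. x d \<noteq> y d" by auto
  then show ?thesis
    using that exists_least_iff[of "\<lambda>d. x d \<noteq> y d"] by blast
qed

lemma omega_less: "i < length u \<Longrightarrow> omega u i = u ! i"
  by (simp add: omega_def)

lemma omega_add: "omega u (length u + i) = omega u i"
  by (simp add: omega_def)

lemma omega_diff: "length u \<le> i \<Longrightarrow> omega u (i - length u) = omega u i"
  using omega_add[of u "i - length u"] by simp

text \<open>Past the end of \<open>u\<close>, the letter at \<open>i\<close> comes from
  \<open>v\<close> at position \<open>i - length u < d\<close>, where \<open>omega u\<close> has the
  same letter; the period of \<open>omega u\<close> brings it back to \<open>i\<close>.\<close>

lemma omega_append_agree: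
  assumes "\<forall>j<d. omega u j = omega v j" "i < length u + d" "i < length u + length v"
  shows "(u @ v) ! i = omega u i"
proof (cases "i < length u")
  case True
  then show ?thesis by (simp add: nth_append omega_less)
next
  case False
  then have "(u @ v) ! i = omega v (i - length u)"
    using assms by (simp add: nth_append omega_less)
  also have "\<dots> = omega u (i - length u)" using False assms by auto
  finally show ?thesis using False by (simp add: omega_diff)
qed

text \<open>A weak form of the Fine-Wilf theorem. From a position beyond
  \<open>length u + length v\<close>, step back by \<open>length u\<close> and then
  \<open>length v\<close>, and return in the opposite order; the induction hypothesis allows the
  change of word at each of the three intermediate positions.\<close>

lemma omega_eqI:
  assumes "u \<noteq> []" "v \<noteq> []" "\<forall>j<length u + length v. omega u j = omega v j"
  shows "omega u = omega v"
proof
  fix i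
  show "omega u i = omega v i"
  proof (induction i rule: less_induct)
    case (less i)
    show ?case
    proof (cases "i < length u + length v")
      case True
      then show ?thesis using assms by auto
    next
      case False
      have "length u > 0" "length v > 0" using assms by auto
      then have "i - length u < i" "i - length v < i" "i - length u - length v < i"
        using False by linarith+
      note IH = this[THEN less]
      have "omega u i = omega u (i - length u)" using False by (simp add: omega_diff)
      also have "\<dots> = omega v (i - length u)" using IH by simp
      also have "\<dots> = omega v (i - length u - length v)"
        using False by (subst omega_diff) auto
      also have "\<dots> = omega u (i - length u - length v)" using IH by simp
      also have "\<dots> = omega u (i - length v - length u)" by (simp add: add.commute)
      also have "\<dots> = omega u (i - length v)" using False by (subst omega_diff) auto
      also have "\<dots> = omega v (i - length v)" using IH by simp
      also have "\<dots> = omega v i" using False by (simp add: omega_diff)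
      finally show ?thesis .
    qed
  qed
qed

text \<open>The common sequence has both periods \<open>length u\<close> and
  \<open>length v\<close>, hence also their sum, and starts with \<open>u @ v\<close>.\<close>

lemma omega_append_eq:
  assumes "omega u = omega v"
  shows "omega (u @ v) = omega v"
proof
  fix i
  show "omega (u @ v) i = omega v i"
  proof (induction i rule: less_induct)
    case (less i)
    show ?case
    proof (cases "i < length u + length v \<or> length u + length v = 0")
      case True
      then show ?thesis
        using assms omega_append_agree[of i u v i] by (cases "u = []") (auto simp: omega_less)
    next
      case False
      then have "i - (length u + length v) < i" by linarith
      note IH = less[OF this]
      have "omega (u @ v) i = omega (u @ v) (i - length (u @ v))"
        using False by (subst omega_diff) auto
      also have "\<dots> = omega v (i - length u - length v)" using IH by simp
      also have "\<dots> = omega u (i - length u)" using False assms by (subst omega_diff) auto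
      also have "\<dots> = omega v i" using False assms by (subst omega_diff) auto
      finally show ?thesis .
    qed
  qed
qed

text \<open>The position of the first difference is the same for \<open>u\<^sup>\<omega>, v\<^sup>\<omega>\<close>, for \<open>uv, vu\<close> and for
  \<open>(uv)\<^sup>\<omega>, v\<^sup>\<omega>\<close>. This is what makes the comparisons below insensitive to the order varying
  with the position.\<close>

lemma omega_first_difference:
  assumes "u \<noteq> []" "v \<noteq> []" "omega u \<noteq> omega v"
  obtains d where "d < length u + length v" "\<forall>j<d. omega u j = omega v j" "omega u d \<noteq> omega v d"
    "\<forall>j\<le>d. (u @ v) ! j = omega u j" "\<forall>j\<le>d. (v @ u) ! j = omega v j"
proof -
  from ex_first_difference[OF assms(3)]
  obtain d where d: "\<forall>j<d. omega u j = omega v j" "omega u d \<noteq> omega v d" .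
  have less: "d < length u + length v"
    using omega_eqI[of u v] assms d by (metis less_le_trans not_less)
  have "length u > 0" "length v > 0" using assms by auto
  then have pos: "j < length u + d" "j < length v + d" "j < length u + length v"
    "j < length v + length u" if "j \<le> d" for j
    using that less by linarith+
  have "\<forall>j\<le>d. (u @ v) ! j = omega u j"
    using omega_append_agree[of d u v] d(1) pos by blast
  moreover have "\<forall>j\<le>d. (v @ u) ! j = omega v j"
    using omega_append_agree[of d v u] d(1) pos by metis
  ultimately show ?thesis using that less d by blast
qed

section \<open>Reduction of the word order to first differences\<close>

lemma glex_less_Inf_iff: "glex_less r (Inf x) (Inf y) \<longleftrightarrow> seq_less r (snth x) (snth y)"
proof
  assume "glex_less r (Inf x) (Inf y)"
  then obtain p a b s t where "Inf x = prepend p (prepend [a] s)"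
    "Inf y = prepend p (prepend [b] t)" and ab: "(a, b) \<in> r (length p + 1)"
    by (auto simp: glex_less_def)
  then obtain s' t' where "x = p @- a ## s'" "y = p @- b ## t'"
    by (cases s; cases t; simp)
  with ab show "seq_less r (snth x) (snth y)"
    unfolding seq_less_def by (intro exI[of _ "length p"]) simp
next
  assume "seq_less r (snth x) (snth y)"
  then obtain d where d: "\<forall>j<d. x !! j = y !! j" "(x !! d, y !! d) \<in> r (Suc d)"
    unfolding seq_less_def by blast
  have "stake d x = stake d y" using d by (intro nth_equalityI) auto
  then have "Inf x = prepend (stake d x) (prepend [x !! d] (Inf (sdrop (Suc d) x)))"
    "Inf y = prepend (stake d x) (prepend [y !! d] (Inf (sdrop (Suc d) y)))"
    using id_stake_snth_sdrop[of x d] id_stake_snth_sdrop[of y d] by auto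
  moreover have "(x !! d, y !! d) \<in> r (length (stake d x) + 1)" using d(2) by simp
  ultimately show "glex_less r (Inf x) (Inf y)"
    unfolding glex_less_def by blast
qed

lemma glex_less_Fin_iff:
  assumes "length x = length y"
  shows "glex_less r (Fin x) (Fin y) \<longleftrightarrow>
    (\<exists>d<length x. (\<forall>j<d. x ! j = y ! j) \<and> (x ! d, y ! d) \<in> r (Suc d))"
proof
  assume "glex_less r (Fin x) (Fin y)"
  moreover have "s = Fin []" if "Fin x = Fin p" "Fin y = prepend p s" for p s
    using that assms by (cases s) auto
  ultimately obtain p a b s t where "Fin x = prepend p (prepend [a] s)"
    "Fin y = prepend p (prepend [b] t)" and ab: "(a, b) \<in> r (length p + 1)"
    unfolding glex_less_def by blast
  then obtain s' t' where "x = p @ a # s'" "y = p @ b # t'"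
    by (cases s; cases t; simp)
  with ab show "\<exists>d<length x. (\<forall>j<d. x ! j = y ! j) \<and> (x ! d, y ! d) \<in> r (Suc d)"
    by (intro exI[of _ "length p"]) (auto simp: nth_append)
next
  assume "\<exists>d<length x. (\<forall>j<d. x ! j = y ! j) \<and> (x ! d, y ! d) \<in> r (Suc d)"
  then obtain d where d: "d < length x" "\<forall>j<d. x ! j = y ! j" "(x ! d, y ! d) \<in> r (Suc d)"
    by blast
  have "take d x = take d y" using d assms by (intro nth_equalityI) auto
  then have "Fin x = prepend (take d x) (prepend [x ! d] (Fin (drop (Suc d) x)))"
    "Fin y = prepend (take d x) (prepend [y ! d] (Fin (drop (Suc d) y)))"
    using id_take_nth_drop[of d x] id_take_nth_drop[of d y] d(1) assms by auto
  moreover have "(x ! d, y ! d) \<in> r (length (take d x) + 1)" using d(1,3) by simp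
  ultimately show "glex_less r (Fin x) (Fin y)"
    unfolding glex_less_def by blast
qed

text \<open>Unrolling the equation determines every letter of \<open>w\<close>. Thus a word equal to
  one of its proper suffixes is not primitive.\<close>

lemma cycle_unique:
  assumes "u \<noteq> []" "w = u @- w"
  shows "w = cycle u"
proof -
  have "w !! n = cycle u !! n" for n
  proof (induction n rule: less_induct)
    case (less n)
    have "w !! n = (u @- w) !! n" using assms(2) by simp
    also have "\<dots> = (u @- cycle u) !! n"
    proof (cases "n < length u")
      case False
      moreover have "length u > 0" using assms(1) by simp
      ultimately have "n - length u < n" by linarith
      with False show ?thesis using less by simp
    qed simp
    finally show ?case using cycle_decomp[OF assms(1)] by simp
  qed
  then show ?thesis using smap_alt[of id w "cycle u"] by (simp add: stream.map_id)
qed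

lemma gen_lyndon_inf_iff:
  "gen_lyndon_inf r w \<longleftrightarrow> (\<forall>k>0. seq_less r (snth w) (\<lambda>j. w !! (k + j)))"
proof -
  have "gen_lyndon_inf r w \<longleftrightarrow> (\<forall>k>0. glex_less r (Inf w) (Inf (sdrop k w)))"
  proof
    assume L: "gen_lyndon_inf r w"
    show "\<forall>k>0. glex_less r (Inf w) (Inf (sdrop k w))"
    proof (intro allI impI)
      fix k :: nat assume "k > 0"
      then have "stake k w \<noteq> []" by simp
      then show "glex_less r (Inf w) (Inf (sdrop k w))"
        using L unfolding gen_lyndon_inf_def by (metis stake_sdrop)
    qed
  next
    assume "\<forall>k>0. glex_less r (Inf w) (Inf (sdrop k w))"
    moreover have "sdrop (length u) (u @- v) = v" for u :: "'a list" and v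
      by (simp add: sdrop_shift)
    ultimately show "gen_lyndon_inf r w"
      unfolding gen_lyndon_inf_def by (metis length_greater_0_conv)
  qed
  moreover have "snth (sdrop k w) = (\<lambda>j. w !! (k + j))" for k
    by (auto simp: sdrop_snth)
  ultimately show ?thesis by (simp add: glex_less_Inf_iff)
qed

lemma lyndon_prefixes_eq:
  "{u. (\<exists>v. w = u @- v) \<and> gen_lyndon_fin r u} =
    (\<lambda>n. stake n w) ` {n. gen_lyndon_fin r (stake n w)}"
proof -
  have "u = stake (length u) (u @- v)" for u :: "'a list" and v
    by (simp add: stake_shift)
  then have "(\<exists>v. w = u @- v) \<longleftrightarrow> (\<exists>n. u = stake n w)" for u
    by (metis stake_sdrop)
  then show ?thesis by auto
qed

lemma infinite_lyndon_prefixes_iff: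
  "infinite {u. (\<exists>v. w = u @- v) \<and> gen_lyndon_fin r u} \<longleftrightarrow>
    infinite {n. gen_lyndon_fin r (stake n w)}"
proof -
  have "inj_on (\<lambda>n. stake n w) A" for A by (metis inj_onI length_stake)
  then show ?thesis by (simp add: lyndon_prefixes_eq finite_image_iff)
qed

section \<open>The order on sequences and on periodic words\<close>

locale linear_orders =
  fixes r :: "nat \<Rightarrow> 'a rel"
  assumes slo: "n > 0 \<Longrightarrow> strict_linear_order (r n)"
begin

abbreviation lt (infix "\<sqsubset>" 50) where "x \<sqsubset> y \<equiv> seq_less r x y"

lemma r_irrefl: "(a, a) \<notin> r (Suc n)"
  using slo[of "Suc n"] by (auto simp: strict_linear_order_on_def irrefl_def)

lemma r_trans: "(a, b) \<in> r (Suc n) \<Longrightarrow> (b, c) \<in> r (Suc n) \<Longrightarrow> (a, c) \<in> r (Suc n)"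
  using slo[of "Suc n"] by (auto simp: strict_linear_order_on_def dest: transD)

lemma r_total: "a \<noteq> b \<Longrightarrow> (a, b) \<in> r (Suc n) \<or> (b, a) \<in> r (Suc n)"
  using slo[of "Suc n"] by (auto simp: strict_linear_order_on_def total_on_def)

text \<open>Irreflexivity forces the witness in \<open>seq_less\<close> to be the first
  difference.\<close>

lemma lt_iff_at:
  assumes "\<forall>j<d. x j = y j" "x d \<noteq> y d"
  shows "x \<sqsubset> y \<longleftrightarrow> (x d, y d) \<in> r (Suc d)"
proof
  assume "x \<sqsubset> y"
  then obtain e where e: "\<forall>j<e. x j = y j" "(x e, y e) \<in> r (Suc e)"
    unfolding seq_less_def by blast
  then have "x e \<noteq> y e" using r_irrefl by metis
  then have "e = d" using e assms by (metis linorder_neqE_nat)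
  then show "(x d, y d) \<in> r (Suc d)" using e by simp
qed (use assms in \<open>auto simp: seq_less_def\<close>)

lemma lt_irrefl: "\<not> x \<sqsubset> x"
  using r_irrefl by (auto simp: seq_less_def)

lemma lt_trans:
  assumes "x \<sqsubset> y" "y \<sqsubset> z" shows "x \<sqsubset> z"
proof -
  obtain d where d: "\<forall>j<d. x j = y j" "(x d, y d) \<in> r (Suc d)"
    using assms unfolding seq_less_def by blast
  obtain e where e: "\<forall>j<e. y j = z j" "(y e, z e) \<in> r (Suc e)"
    using assms unfolding seq_less_def by blast
  consider "d < e" | "d = e" | "e < d" by linarith
  then show ?thesis
  proof cases
    case 1 then show ?thesis using d e unfolding seq_less_def by (intro exI[of _ d]) auto
  next
    case 2 then show ?thesis using d e r_trans unfolding seq_less_def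
      by (intro exI[of _ d]) auto
  next
    case 3 then show ?thesis using d e unfolding seq_less_def by (intro exI[of _ e]) auto
  qed
qed

lemma lt_total: "x \<noteq> y \<Longrightarrow> x \<sqsubset> y \<or> y \<sqsubset> x"
proof -
  assume "x \<noteq> y"
  then obtain d where d: "\<forall>j<d. x j = y j" "x d \<noteq> y d" by (rule ex_first_difference)
  then show ?thesis using r_total[of "x d" "y d" d] unfolding seq_less_def by metis
qed

lemma lt_asymp_transp: "asymp_on A lt" "transp_on A lt"
  using lt_irrefl lt_trans by (auto intro!: asymp_onI transp_onI)

text \<open>Up to and including the first difference of \<open>omega u\<close> and
  \<open>omega v\<close>, \<open>omega (u @ v)\<close> coincides with \<open>omega u\<close>, so
  both comparisons are decided at the same position by the same letters.\<close>

lemma lt_omega_append_iff: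
  assumes "u \<noteq> []" "v \<noteq> []"
  shows "omega (u @ v) \<sqsubset> omega v \<longleftrightarrow> omega u \<sqsubset> omega v"
proof (cases "omega u = omega v")
  case True
  then show ?thesis by (simp add: omega_append_eq)
next
  case False
  obtain d where d: "d < length u + length v" "\<forall>j<d. omega u j = omega v j"
    "omega u d \<noteq> omega v d" "\<forall>j\<le>d. (u @ v) ! j = omega u j"
    by (rule omega_first_difference[OF assms False])
  have "\<forall>j\<le>d. omega (u @ v) j = omega u j" using d by (simp add: omega_less)
  then show ?thesis using d lt_iff_at[of d "omega (u @ v)" "omega v"]
      lt_iff_at[of d "omega u" "omega v"] by auto
qed

lemma glex_less_commuted:
  assumes "u \<noteq> []" "v \<noteq> []" "omega u \<sqsubset> omega v"
  shows "glex_less r (Fin (u @ v)) (Fin (v @ u))"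
proof -
  have neq: "omega u \<noteq> omega v" using assms lt_irrefl by auto
  obtain d where d: "d < length u + length v" "\<forall>j<d. omega u j = omega v j"
    "omega u d \<noteq> omega v d" "\<forall>j\<le>d. (u @ v) ! j = omega u j" "\<forall>j\<le>d. (v @ u) ! j = omega v j"
    by (rule omega_first_difference[OF assms(1,2) neq])
  then show ?thesis using lt_iff_at[OF d(2,3)] assms
    by (subst glex_less_Fin_iff) (auto intro!: exI[of _ d])
qed

section \<open>From Lyndon prefixes to the infinite word\<close>

lemma infinite_lyndon_prefixes_imp_lyndon:
  assumes "primitive_inf w" "infinite {n. gen_lyndon_fin r (stake n w)}"
  shows "gen_lyndon_inf r w"
  unfolding gen_lyndon_inf_iff
proof (intro allI impI)
  fix k :: nat assume k: "k > 0"
  have "snth w \<noteq> (\<lambda>j. w !! (k + j))"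
  proof
    assume "snth w = (\<lambda>j. w !! (k + j))"
    then have "w !! n = sdrop k w !! n" for n by (metis sdrop_snth)
    then have "w = sdrop k w" using smap_alt[of id w "sdrop k w"] by (simp add: stream.map_id)
    then have "w = stake k w @- w" by (metis stake_sdrop)
    then show False using assms(1) cycle_unique[of "stake k w" w] k
      unfolding primitive_inf_def by (metis stake_invert_Nil less_irrefl)
  qed
  then obtain d where d: "\<forall>j<d. w !! j = w !! (k + j)" "w !! d \<noteq> w !! (k + d)"
    by (rule ex_first_difference)
  \<comment> \<open>The prefix is long enough to contain both differing letters, at \<open>d\<close>
    and at \<open>k + d\<close>.\<close>
  obtain n where n: "n > k + d" "gen_lyndon_fin r (stake n w)"
    using assms(2) by (auto simp: infinite_nat_iff_unbounded)
  define x where "x = stake n w"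
  \<comment> \<open>The conjugate \<open>y\<close> of \<open>x\<close> agrees with the suffix of
    \<open>w\<close> at \<open>k\<close> on its first \<open>n - k\<close> letters, which include
    position \<open>d\<close>.\<close>
  define y where "y = drop k x @ take k x"
  have len: "length x = n" "length y = n" by (simp_all add: x_def y_def)
  have "x = take k x @ drop k x" "take k x \<noteq> []" "drop k x \<noteq> []" using k n(1) len by auto
  then have "glex_less r (Fin x) (Fin y)"
    using n(2) unfolding gen_lyndon_fin_def x_def[symmetric] y_def by metis
  then obtain e where e: "e < n" "\<forall>j<e. x ! j = y ! j" "(x ! e, y ! e) \<in> r (Suc e)"
    using glex_less_Fin_iff[of x y r] len by auto
  have eq: "x ! j = w !! j" "y ! j = w !! (k + j)" if "j < n - k" for j
    using that by (simp_all add: x_def y_def nth_append)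
  have dn: "d < n - k" using n(1) by simp
  have "x ! e \<noteq> y ! e" using e(3) r_irrefl by metis
  have "e = d"
  proof (rule linorder_cases[of e d])
    assume "e < d"
    then show ?thesis using eq[of e] d(1) dn \<open>x ! e \<noteq> y ! e\<close> by auto
  next
    assume "d < e"
    then show ?thesis using eq[OF dn] d(2) e(2) by auto
  qed
  then show "snth w \<sqsubset> (\<lambda>j. w !! (k + j))"
    using e(3) d(1) eq[OF dn] unfolding seq_less_def by (intro exI[of _ d]) auto
qed

section \<open>Minimal suffixes of prefixes\<close>

lemma gen_lyndon_finI:
  assumes "w \<noteq> []" "\<And>u v. w = u @ v \<Longrightarrow> u \<noteq> [] \<Longrightarrow> v \<noteq> [] \<Longrightarrow> omega w \<sqsubset> omega v"
  shows "gen_lyndon_fin r w"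
  unfolding gen_lyndon_fin_def
proof (intro conjI allI impI)
  fix u v assume *: "u \<noteq> []" "v \<noteq> []" "w = u @ v"
  then have "omega u \<sqsubset> omega v" using assms(2) lt_omega_append_iff by blast
  then show "glex_less r (Fin (u @ v)) (Fin (v @ u))" using * glex_less_commuted by blast
qed (fact assms(1))

text \<open>A proper nonempty suffix of \<open>v\<close> is also a suffix of \<open>p\<close>:
  minimality keeps its power from being smaller than \<open>omega v\<close>, and the choice of a
  shortest \<open>v\<close> keeps it from being equal.\<close>

lemma ex_minimal_suffix:
  assumes "p \<noteq> []"
  obtains x v where "p = x @ v" "gen_lyndon_fin r v"
    "\<And>y s. p = y @ s \<Longrightarrow> s \<noteq> [] \<Longrightarrow> \<not> omega s \<sqsubset> omega v"
proof -
  let ?S = "{s. s \<noteq> [] \<and> (\<exists>y. p = y @ s)}"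
  have "?S \<subseteq> (\<lambda>i. drop i p) ` {..length p}"
  proof
    fix s assume "s \<in> ?S"
    then obtain y where "p = y @ s" by auto
    then show "s \<in> (\<lambda>i. drop i p) ` {..length p}" by (intro image_eqI[of _ _ "length y"]) auto
  qed
  then have "finite ?S" by (rule finite_subset) simp
  moreover have "?S \<noteq> {}" using assms by auto
  ultimately obtain m where m: "m \<in> omega ` ?S" "\<forall>y\<in>omega ` ?S. y \<noteq> m \<longrightarrow> \<not> y \<sqsubset> m"
    using Finite_Set.bex_min_element[of "omega ` ?S" lt] lt_asymp_transp by blast
  define v where "v = (ARG_MIN length s. s \<in> ?S \<and> omega s = m)"
  from m(1) obtain s where "s \<in> ?S \<and> omega s = m" by auto
  from arg_min_nat_lemma[of "\<lambda>s. s \<in> ?S \<and> omega s = m", OF this, of length]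
  have v: "v \<in> ?S" "omega v = m"
    and least: "\<And>s. s \<in> ?S \<Longrightarrow> omega s = m \<Longrightarrow> length v \<le> length s"
    unfolding v_def by simp_all
  have min: "\<not> omega s \<sqsubset> omega v" if "s \<in> ?S" for s
    using m(2) that v(2) lt_irrefl by (cases "omega s = m") auto
  obtain x where x: "p = x @ v" using v(1) by auto
  have "gen_lyndon_fin r v"
  proof (rule gen_lyndon_finI)
    show "v \<noteq> []" using v(1) by auto
  next
    fix u s assume s: "v = u @ s" "u \<noteq> []" "s \<noteq> []"
    then have "s \<in> ?S" using x by auto
    moreover from this have "omega s \<noteq> omega v" using least[of s] v(2) s by auto
    ultimately show "omega v \<sqsubset> omega s" using min[of s] lt_total[of "omega v" "omega s"] by auto
  qed
  moreover have "\<not> omega s \<sqsubset> omega v" if "p = y @ s" "s \<noteq> []" for y s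
    using min[of s] that by auto
  ultimately show ?thesis using that x by blast
qed

text \<open>\<open>w\<close> is below its suffix starting with \<open>v\<close>. A first difference
  inside \<open>v\<close> would put the power of the whole prefix below \<open>omega v\<close>,
  against \<open>min\<close>.\<close>

lemma minimal_suffix_is_prefix:
  assumes "gen_lyndon_inf r w" "stake n w = x @ v" "v \<noteq> []"
    and min: "\<not> omega (stake n w) \<sqsubset> omega v"
  shows "v = stake (length v) w"
proof (cases "x = []")
  case True
  then show ?thesis using assms(2) by (metis append_Nil length_stake)
next
  case False
  have n: "n = length x + length v" using assms(2) by (metis length_append length_stake)
  have v: "v ! j = w !! (length x + j)" if "j < length v" for j
    using that n stake_nth[of "length x + j" n w] unfolding assms(2) by simp
  obtain d where d: "\<forall>j<d. w !! j = w !! (length x + j)" "(w !! d, w !! (length x + d)) \<in> r (Suc d)"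
    using assms(1) False unfolding gen_lyndon_inf_iff seq_less_def by blast
  have "length v \<le> d"
  proof (rule ccontr)
    assume less: "\<not> length v \<le> d"
    have "omega (stake n w) j = w !! j" "omega v j = w !! (length x + j)" if "j \<le> d" for j
      using that less n v by (auto simp: omega_less)
    then have "omega (stake n w) \<sqsubset> omega v"
      using d unfolding seq_less_def by (intro exI[of _ d]) auto
    with min show False by contradiction
  qed
  then show ?thesis using d(1) v by (intro nth_equalityI) auto
qed

section \<open>From the infinite word to Lyndon prefixes\<close>

lemma lyndon_imp_infinite_lyndon_prefixes:
  assumes lyndon: "gen_lyndon_inf r w"
  shows "infinite {n. gen_lyndon_fin r (stake n w)}"
proof
  assume fin: "finite {n. gen_lyndon_fin r (stake n w)}"
  define M where "M = (\<lambda>n. omega (stake n w)) ` {n. gen_lyndon_fin r (stake n w)}"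
  \<comment> \<open>\<open>m\<close> is the minimal power of a nonempty suffix of the prefix of
    length \<open>n\<close>.\<close>
  define P where "P n m \<longleftrightarrow> (\<exists>x v. v \<noteq> [] \<and> stake n w = x @ v \<and> omega v = m \<and>
    (\<forall>y s. stake n w = y @ s \<longrightarrow> s \<noteq> [] \<longrightarrow> \<not> omega s \<sqsubset> m))" for n m
  have "finite M" using fin by (simp add: M_def)
  have ex: "\<exists>m\<in>M. P n m" if "n > 0" for n
  proof -
    from that have "stake n w \<noteq> []" by simp
    from ex_minimal_suffix[OF this]
    obtain x v where xv: "stake n w = x @ v" "gen_lyndon_fin r v"
      "\<And>y s. stake n w = y @ s \<Longrightarrow> s \<noteq> [] \<Longrightarrow> \<not> omega s \<sqsubset> omega v"
      by blast
    have "v \<noteq> []" using xv(2) by (simp add: gen_lyndon_fin_def)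
    moreover have "\<not> omega (stake n w) \<sqsubset> omega v" using xv(3)[of "[]" "stake n w"] that by simp
    ultimately have "v = stake (length v) w"
      using minimal_suffix_is_prefix[OF lyndon xv(1)] by blast
    then have "omega v \<in> M" using xv(2) unfolding M_def by (metis (mono_tags) imageI mem_Collect_eq)
    moreover have "P n (omega v)" using xv \<open>v \<noteq> []\<close> unfolding P_def by blast
    ultimately show ?thesis by blast
  qed
  define F where "F = {m \<in> M. \<exists>\<^sub>\<infinity>n. P n m}"
  have "\<exists>\<^sub>\<infinity>n. \<exists>m\<in>M. P n m" using ex unfolding INFM_nat by (metis gr_zeroI lessI less_trans)
  then have "F \<noteq> {}" using frequently_bex_finite[OF \<open>finite M\<close>] unfolding F_def by blast
  moreover have "finite F" using \<open>finite M\<close> by (simp add: F_def)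
  ultimately obtain m where m: "m \<in> F" "\<forall>y\<in>F. y \<noteq> m \<longrightarrow> \<not> m \<sqsubset> y"
    using Finite_Set.bex_max_element[of F lt] lt_asymp_transp by blast
  \<comment> \<open>Beyond some \<open>N\<close> only values in \<open>F\<close> occur, so
    \<open>m\<close> is maximal among all values there.\<close>
  have "\<forall>\<^sub>\<infinity>n. \<forall>y\<in>M - F. \<not> P n y"
    by (rule eventually_ball_finite) (use \<open>finite M\<close> in \<open>auto simp: F_def\<close>)
  then obtain N where N: "\<And>n y. n > N \<Longrightarrow> y \<in> M - F \<Longrightarrow> \<not> P n y"
    unfolding MOST_nat by blast
  have max: "\<not> m \<sqsubset> y" if "n > N" "y \<in> M" "P n y" for n y
    using N[of n y] m(2) that lt_irrefl by (cases "y = m") auto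

  \<comment> \<open>Stripping minimal suffixes from the end extends the agreement with
    \<open>m\<close> to the left, keeping its right end \<open>n'\<close>, until its start is at
    most \<open>N\<close>. For \<open>n' = n\<close> the second premise is vacuous.\<close>
  have strip: "\<exists>n0\<le>N. \<forall>j. n0 + j < n' \<longrightarrow> w !! (n0 + j) = m j"
    if "P n m" "\<forall>j. n + j < n' \<longrightarrow> w !! (n + j) = m j" for n n'
    using that
  proof (induction n rule: less_induct)
    case (less n)
    then obtain x v where xv: "v \<noteq> []" "stake n w = x @ v" "omega v = m"
      "\<And>y s. stake n w = y @ s \<Longrightarrow> s \<noteq> [] \<Longrightarrow> \<not> omega s \<sqsubset> m"
      unfolding P_def by blast
    let ?k = "length x"
    have n: "n = ?k + length v" using xv(2) by (metis length_append length_stake)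
    have v: "w !! (?k + j) = m j" if "j < length v" for j
      using that n stake_nth[of "?k + j" n w] xv(3) unfolding xv(2) by (auto simp: omega_less)
    have ext: "w !! (?k + j) = m j" if "?k + j < n'" for j
    proof (cases "j < length v")
      case False
      then have eq: "n + (j - length v) = ?k + j" using n by simp
      then have "w !! (?k + j) = m (j - length v)" using less.prems(2) that by metis
      then show ?thesis using False xv(3) omega_diff[of v j] by simp
    qed (use v in blast)
    show ?case
    proof (cases "?k \<le> N")
      case True
      then show ?thesis using ext by blast
    next
      case False
      then have "?k > 0" by linarith
      then obtain m' where m': "m' \<in> M" "P ?k m'" using ex by blast
      have "stake ?k w = x"
        using n xv(2) take_stake[of ?k n w] by (simp add: min_def)
      then obtain x' v' where x': "v' \<noteq> []" "x = x' @ v'" "omega v' = m'"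
        using m'(2) unfolding P_def by auto
      \<comment> \<open>\<open>v' @ v\<close> is a suffix of the longer prefix, so its power is not
        below \<open>m\<close>; hence neither is \<open>m'\<close>, and maximality of
        \<open>m\<close> gives equality.\<close>
      have "\<not> omega (v' @ v) \<sqsubset> omega v" using xv(4)[of x' "v' @ v"] x' xv by simp
      then have "\<not> m' \<sqsubset> m" using lt_omega_append_iff[OF x'(1) xv(1)] x' xv by simp
      moreover have "\<not> m \<sqsubset> m'" using max[of ?k m'] False m' by simp
      ultimately have "P ?k m" using m' lt_total by metis
      moreover have "?k < n" using n xv(1) by simp
      ultimately show ?thesis using less.IH ext by blast
    qed
  qed
  have inf: "\<exists>\<^sub>\<infinity>n. P n m" using m(1) by (simp add: F_def)
  then have "\<exists>\<^sub>\<infinity>n. \<exists>n0\<in>{..N}. \<forall>j. n0 + j < n \<longrightarrow> w !! (n0 + j) = m j"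
  proof (rule frequently_elim1)
    fix n assume "P n m"
    from strip[OF this, of n] show "\<exists>n0\<in>{..N}. \<forall>j. n0 + j < n \<longrightarrow> w !! (n0 + j) = m j"
      by auto
  qed
  \<comment> \<open>As \<open>n0\<close> is bounded by \<open>N\<close>, a single one serves
    infinitely many \<open>n\<close>, so the agreement with \<open>m\<close> has no right
    end.\<close>
  then have "\<exists>n0\<in>{..N}. \<exists>\<^sub>\<infinity>n. \<forall>j. n0 + j < n \<longrightarrow> w !! (n0 + j) = m j"
    by (rule frequently_bex_finite[rotated]) simp
  then obtain n0 where n0: "w !! (n0 + j) = m j" for j
    unfolding INFM_nat by blast
  obtain v where v: "v \<noteq> []" "omega v = m"
    using inf unfolding INFM_nat P_def by blast
  \<comment> \<open>Skipping one more period makes the suffix proper even when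
    \<open>n0 = 0\<close>.\<close>
  have m_suffix: "(\<lambda>j. w !! (n0 + length v + j)) = m"
    using n0 omega_add[of v] v(2) by (auto simp: add.assoc)
  have "n0 + length v > 0" using v(1) by simp
  then have "snth w \<sqsubset> (\<lambda>j. w !! (n0 + length v + j))"
    using lyndon[unfolded gen_lyndon_inf_iff, rule_format, of "n0 + length v"] by simp
  then have "snth w \<sqsubset> m" by (simp only: m_suffix)
  then obtain d where d: "\<forall>j<d. w !! j = m j" "(w !! d, m d) \<in> r (Suc d)"
    unfolding seq_less_def by blast
  \<comment> \<open>A prefix reaching past \<open>d\<close> inherits \<open>w < m\<close>, although
    it is one of its own suffixes and \<open>m\<close> is minimal for it.\<close>
  obtain n where n: "n > d" "P n m" using inf unfolding INFM_nat by blast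
  then have "stake n w = [] @ stake n w" "stake n w \<noteq> []" by auto
  then have "\<not> omega (stake n w) \<sqsubset> m" using n(2) unfolding P_def by blast
  moreover have "omega (stake n w) \<sqsubset> m"
    using d n(1) unfolding seq_less_def by (intro exI[of _ d]) (auto simp: omega_less)
  ultimately show False by contradiction
qed

end

theorem theorem8:
  fixes r :: "nat \<Rightarrow> 'a rel" and w :: "'a stream"
  assumes "\<And>n. n \<ge> 1 \<Longrightarrow> strict_linear_order (r n)"
    and "primitive_inf w"
  shows "gen_lyndon_inf r w \<longleftrightarrow>
    infinite {u. (\<exists>v. w = u @- v) \<and> gen_lyndon_fin r u}"
proof -
  interpret linear_orders r by unfold_locales (use assms(1) in simp)
  show ?thesis
    unfolding infinite_lyndon_prefixes_iff
    using lyndon_imp_infinite_lyndon_prefixes infinite_lyndon_prefixes_imp_lyndon[OF assms(2)]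
    by blast
qed

end
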